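(* For $n\ge 1$ let $D_n$ denote the degree of the root vertex in a uniformly random rooted map with $n$ edges (no restriction on genus). Then, as $n\to\infty$, $D_n$ divided by the number of edges converges in law to the uniform distribution on $[0,2]$: $$\frac{D_n}{n}\ \overset{d}{\longrightarrow}\ \mathrm{Uniform}[0,2].$$
   Context: A map is a connected multigraph (loops and multiple edges allowed) endowed with a cyclic ordering of the half-edges incident to each vertex. The degree of a vertex is the number of half-edges incident to it (so a loop contributes 2). Around each vertex, each pair of consecutive half-edges in the cyclic order forms a corner (a vertex with only one half-edge has one corner; a vertex of degree $d\ge1$ has $d$ corners; the one-vertex map with no edge has exactly one corner). A rooted map is a map with a distinguished corner; the vertex at this corner is the root vertex. Rooted maps are considered up to isomorphisms preserving the graph structure, the root corner and the cyclic orderings. "Random rooted map with $n$ edges" means that all rooted maps with $n$ edges are equally likely. $\overset{d}{\longrightarrow}$ is convergence in distribution. *)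

theory Defs
  imports "HOL-Probability.Probability" "Graph_Theory.Graph_Theory"
begin

text \<open>
  A finite undirected multigraph, with loops and multiple edges allowed, is represented by a
  bidirected digraph of \<^theory>\<open>Graph_Theory.Bidirected_Digraph\<close>: an arc \<open>a\<close> stands for
  the half-edge incident to the vertex \<open>tail G a\<close>, and the fixed-point-free involution \<open>opp\<close>
  maps a half-edge to the other half of its edge. Consequently the edges are the sets
  \<open>{a, opp a}\<close>, and the degree of \<open>v\<close> (where a loop contributes 2) is \<open>out_degree G v\<close>.
  The permutation \<open>rot\<close> sends a half-edge to its successor around its vertex.
\<close>

record ('v, 'h) cmap =
  underlying :: "('v, 'h) pre_digraph"
  opp :: "'h \<Rightarrow> 'h"
  rot :: "'h \<Rightarrow> 'h"

definition is_cmap :: "('v, 'h, 'z) cmap_scheme \<Rightarrow> bool" where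
  "is_cmap M \<longleftrightarrow>
     fin_digraph (underlying M) \<and>
     bidirected_digraph (underlying M) (opp M) \<and>
     connected (underlying M) \<and>
     rot M permutes arcs (underlying M) \<and>
     (\<forall>v \<in> verts (underlying M). out_arcs (underlying M) v \<noteq> {} \<longrightarrow>
        cyclic_on (rot M) (out_arcs (underlying M) v))"

definition edges :: "('v, 'h, 'z) cmap_scheme \<Rightarrow> 'h set set" where
  "edges M = (\<lambda>a. {a, opp M a}) ` arcs (underlying M)"

text \<open>
  \<open>After a\<close> is the corner between the consecutive half-edges \<open>a\<close> and \<open>rot a\<close>. A vertex
  without half-edges, which occurs only in the map without edges, has the single corner
  \<open>At_isolated v\<close>.
\<close>

datatype ('v, 'h) corner = After 'h | At_isolated 'v

definition corners :: "('v, 'h, 'z) cmap_scheme \<Rightarrow> ('v, 'h) corner set" where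
  "corners M = After ` arcs (underlying M) \<union>
     At_isolated ` {v \<in> verts (underlying M). out_arcs (underlying M) v = {}}"

fun corner_vertex :: "('v, 'h, 'z) cmap_scheme \<Rightarrow> ('v, 'h) corner \<Rightarrow> 'v" where
  "corner_vertex M (After a) = tail (underlying M) a"
| "corner_vertex M (At_isolated v) = v"

record ('v, 'h) rooted_map = "('v, 'h) cmap" +
  root_corner :: "('v, 'h) corner"

definition is_rooted_map :: "('v, 'h) rooted_map \<Rightarrow> bool" where
  "is_rooted_map M \<longleftrightarrow> is_cmap M \<and> root_corner M \<in> corners M"

definition root_degree :: "('v, 'h) rooted_map \<Rightarrow> nat" where
  "root_degree M = out_degree (underlying M) (corner_vertex M (root_corner M))"

definition rooted_map_iso :: "('v, 'h) rooted_map \<Rightarrow> ('w, 'k) rooted_map \<Rightarrow> bool" where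
  "rooted_map_iso M N \<longleftrightarrow> (\<exists>f.
     pre_digraph.digraph_isomorphism (underlying M) f \<and>
     underlying N = app_iso f (underlying M) \<and>
     (\<forall>a \<in> arcs (underlying M). opp N (iso_arcs f a) = iso_arcs f (opp M a)) \<and>
     (\<forall>a \<in> arcs (underlying M). rot N (iso_arcs f a) = iso_arcs f (rot M a)) \<and>
     root_corner N = map_corner (iso_verts f) (iso_arcs f) (root_corner M))"

text \<open>
  Since maps are finite, every isomorphism class has representatives whose vertices and
  half-edges are natural numbers.
\<close>

definition rooted_maps :: "nat \<Rightarrow> (nat, nat) rooted_map set" where
  "rooted_maps n = {M. is_rooted_map M \<and> card (edges M) = n}"

definition rooted_map_classes :: "nat \<Rightarrow> (nat, nat) rooted_map set set" where
  "rooted_map_classes n =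
     rooted_maps n // {(M, N). M \<in> rooted_maps n \<and> N \<in> rooted_maps n \<and> rooted_map_iso M N}"

text \<open>There are finitely many classes for each \<open>n\<close>, and at least one, so this is the uniform law.\<close>

definition random_rooted_map :: "nat \<Rightarrow> (nat, nat) rooted_map set pmf" where
  "random_rooted_map n = pmf_of_set (rooted_map_classes n)"

text \<open>The common root degree of the members of an isomorphism class.\<close>

definition class_root_degree :: "('v, 'h) rooted_map set \<Rightarrow> nat" where
  "class_root_degree C = the_elem (root_degree ` C)"

end

theory Submission
  imports Defs "HOL-Real_Asymp.Real_Asymp"
begin

text \<open>
  Rooting kills all automorphisms, so every rooted map with \<open>n\<close> edges arises from the same number of
  pairs of a fixed pairing \<open>\<alpha>\<close> of \<open>2n\<close> labelled half-edges and a permutation \<open>\<sigma>\<close> acting transitively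
  together with \<open>\<alpha>\<close>; the root degree is the length of the cycle of \<open>\<sigma>\<close> through the root half-edge. For a
  uniform permutation this length is uniform on \<open>{1..2n}\<close>. A non-transitive \<open>\<sigma>\<close> preserves a union of
  \<open>k\<close> edges with \<open>0 < k < n\<close>, which has probability at most
  \<open>\<Sum>k. (n choose k) / (2n choose 2k) \<le> \<Sum>k. 1 / (n choose k) = O(1/n)\<close>, so conditioning on
  transitivity does not change the limit law.
\<close>

section \<open>Cycle lengths and invariant sets of permutations\<close>

text \<open>A map with at least one edge is determined by its half-edges: a vertex is a cycle of
  \<open>rot\<close>, an edge is a pair under \<open>opp\<close>, and connectedness says that the
  two act transitively. The definition of isomorphism also speaks of vertices, heads and tails, so
  the passage from maps to permutations rests on showing that a bijection of half-edges already
  carries all of this. Once the half-edges are labelled with the root at 0 and the edges at {2j, 2j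
  + 1}, the remaining freedom is the group of permutations that fix 0 and commute with \<alpha>. It
  has order 2^(n-1) (n-1)! and acts on the transitive rotations by conjugation with trivial
  stabilisers, so every class has equally many labellings. This number cancels from all
  probabilities, and only its positivity enters. The 2 in [0,2] is the ratio of half-edges to edges.
  Uniformity of the cycle length comes from a recursion that deletes the successor of the root
  half-edge from its cycle.\<close>

lemma orbit_comp_transpose:
  assumes "p b = b" "a \<noteq> b" "p permutes S" "finite S"
  shows "orbit (p \<circ> Transposition.transpose a b) a = insert b (orbit p a)" "b \<notin> orbit p a"
\<comment> \<open>The permutation q runs from a to b to p a and agrees with p elsewhere: the fixed
  point b is spliced into the cycle of a directly behind a.\<close>
proof -
  define q where "q = p \<circ> Transposition.transpose a b"
  have [simp]: "q a = b" "q b = p a" using assms by (auto simp: q_def)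
  have other: "q x = p x" if "x \<noteq> a" "x \<noteq> b" for x using that by (simp add: q_def Transposition.transpose_def)
  have inj: "inj p" using assms(3) permutes_inj by blast
  have nb: "p x \<noteq> b" if "x \<noteq> b" for x using that assms(1) inj by (metis injD)
  have pne: "x \<noteq> b" if "x \<in> orbit p a" for x
    using that by induct (use nb assms(2) in auto)
  then show "b \<notin> orbit p a" by blast
  have b1: "b \<in> orbit q a" using orbit.base[of q a] by (simp only: \<open>q a = b\<close>)
  have pa: "p a \<in> orbit q a" using orbit.step[OF b1] by (simp only: \<open>q b = p a\<close>)
  have "x \<in> orbit q a" if "x \<in> orbit p a" for x
    using that
  proof induct
    case base show ?case using pa .
  next
    case (step x)
    then show ?case
      by (cases "x = a") (use pa pne[OF step(1)] other orbit.step[OF step(2)] in auto)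
  qed
  moreover have "x \<in> insert b (orbit p a)" if "x \<in> orbit q a" for x
    using that
  proof induct
    case base show ?case by simp
  next
    case (step x)
    then show ?case
      by (cases "x = a"; cases "x = b") (auto simp: other intro: orbit.intros)
  qed
  ultimately show "orbit (p \<circ> Transposition.transpose a b) a = insert b (orbit p a)"
    using b1 by (auto simp: q_def)
qed

text \<open>Induction on d. A permutation q whose cycle through a has length d + 1 is p composed
  with the transposition of a and b for exactly one pair: b must be q a, and p fixes b and has a
  cycle of length d through a. With card S - 1 choices of b and (card S - 2)! choices of p on S -
  {b}, the count stays (card S - 1)! at every length.\<close>

lemma card_permutes_orbit:
  assumes "finite S" "a \<in> S" "1 \<le> d" "d \<le> card S"
  shows "card {p. p permutes S \<and> card (orbit p a) = d} = fact (card S - 1)"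
  using assms(3,1,2,4)
proof (induction d arbitrary: S rule: nat_induct_at_least)
  case base
  have "{p. p permutes S \<and> card (orbit p a) = 1} = {p. p permutes (S - {a})}" (is "?L = ?R")
  proof (intro equalityI subsetI)
    fix p assume "p \<in> ?L"
    then have p: "p permutes S" and 1: "card (orbit p a) = 1" by auto
    have "permutation p" using p base(1) permutation_permutes by blast
    then have "a \<in> orbit p a" by (rule permutation_self_in_orbit)
    with 1 have "orbit p a = {a}" by (metis card_1_singletonE singletonD)
    then have "p a = a" by (simp add: orbit_eq_singleton_iff)
    then show "p \<in> ?R" using permutes_superset[OF p, of "S - {a}"] by auto
  next
    fix p assume "p \<in> ?R"
    then have p: "p permutes (S - {a})" by simp
    then have "p a = a" by (simp add: permutes_not_in)
    then have "orbit p a = {a}" by (simp add: orbit_eq_singleton_iff)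
    with p show "p \<in> ?L" by (auto intro: permutes_subset)
  qed
  then show ?case using base by (simp add: card_permutations)
next
  case (Suc d)
  let ?T = "S - {a}"
  let ?A = "\<lambda>b. {p. p permutes (S - {b}) \<and> card (orbit p a) = d}"
  let ?f = "\<lambda>(b, p). p \<circ> Transposition.transpose a b"
  let ?L = "{p. p permutes S \<and> card (orbit p a) = Suc d}"
  have fixb: "p b = b" if "p \<in> ?A b" for p b using that by (auto simp: permutes_not_in)
  have orb: "card (orbit (p \<circ> Transposition.transpose a b) a) = Suc (card (orbit p a))"
    if "p b = b" "p permutes S" "b \<in> ?T" for p b
  proof -
    have "a \<in> orbit p a" using that(2) \<open>finite S\<close> permutation_permutes permutation_self_in_orbit by metis
    then have "finite (orbit p a)" by (rule finite_orbit)
    with orbit_comp_transpose[OF that(1) _ that(2) \<open>finite S\<close>, of a] that(3) show ?thesis by auto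
  qed
  have "bij_betw ?f (Sigma ?T ?A) ?L"
  proof (rule bij_betwI')
    fix x y assume "x \<in> Sigma ?T ?A" "y \<in> Sigma ?T ?A"
    then obtain b p c q where xy: "x = (b, p)" "y = (c, q)" and *: "b \<in> ?T" "c \<in> ?T" "p \<in> ?A b" "q \<in> ?A c"
      by auto
    have pq: "p b = b" "q c = c" using fixb *(3,4) by blast+
    show "(?f x = ?f y) = (x = y)"
    proof
      assume "?f x = ?f y"
      then have eq: "p \<circ> Transposition.transpose a b = q \<circ> Transposition.transpose a c" by (simp add: xy)
      from fun_cong[OF eq, of a] have "b = c" by (simp add: pq)
      moreover from eq this have "p = q" by (metis comp_assoc comp_id transpose_comp_involutory)
      ultimately show "x = y" by (simp add: xy)
    qed simp
  next
    fix x assume "x \<in> Sigma ?T ?A"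
    then obtain b p where x: "x = (b, p)" and *: "b \<in> ?T" "p \<in> ?A b" by auto
    then have p: "p permutes S" by (auto intro: permutes_subset)
    moreover have "Transposition.transpose a b permutes S" using * Suc by (auto intro: permutes_swap_id)
    ultimately have "p \<circ> Transposition.transpose a b permutes S" by (rule permutes_compose[rotated])
    then show "?f x \<in> ?L" using orb[OF fixb[OF *(2)] p *(1)] * by (simp add: x)
  next
    fix q assume "q \<in> ?L"
    then have q: "q permutes S" "card (orbit q a) = Suc d" by auto
    define b where "b = q a"
    define p where "p = q \<circ> Transposition.transpose a b"
    have qp: "q = p \<circ> Transposition.transpose a b"
      unfolding p_def comp_assoc transpose_comp_involutory by simp
    have "b \<noteq> a"
    proof
      assume "b = a"
      then have "orbit q a = {a}" by (simp add: orbit_eq_singleton_iff b_def)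
      with q Suc show False by auto
    qed
    moreover have "b \<in> S" using q Suc by (simp add: b_def permutes_in_image)
    ultimately have b: "b \<in> ?T" by simp
    then have "Transposition.transpose a b permutes S" using Suc by (auto intro: permutes_swap_id)
    then have pS: "p permutes S" unfolding p_def using q(1) by (rule permutes_compose)
    have "p b = b" by (simp add: p_def b_def)
    then have "p permutes (S - {b})" using permutes_superset[OF pS, of "S - {b}"] by auto
    moreover have "card (orbit p a) = d" using orb[OF \<open>p b = b\<close> pS b] q qp by simp
    ultimately show "\<exists>x\<in>Sigma ?T ?A. q = ?f x" using b qp by (intro bexI[of _ "(b, p)"]) auto
  qed
  then have "card ?L = card (Sigma ?T ?A)" by (simp add: bij_betw_same_card)
  also have "\<dots> = (\<Sum>b\<in>?T. card (?A b))"
    using Suc by (intro card_SigmaI) (auto intro: finite_subset[OF _ finite_permutations[of S]] permutes_subset)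
  also have "\<dots> = (\<Sum>b\<in>?T. fact (card S - 2))"
  proof (intro sum.cong refl)
    fix b assume b: "b \<in> ?T"
    then have c: "card (S - {b}) = card S - 1" using Suc by simp
    have "card (?A b) = fact (card (S - {b}) - 1)"
      using Suc.prems b by (intro Suc.IH) (auto simp: c)
    then show "card (?A b) = fact (card S - 2)" by (simp add: c numeral_2_eq_2)
  qed
  also have "\<dots> = (card S - 1) * fact (card S - 2)" using Suc by simp
  also have "\<dots> = fact (card S - 1)"
    using Suc by (subst (2) fact_reduce) (auto simp: numeral_2_eq_2)
  finally show ?case .
qed

lemma card_permutes_orbit_le:
  assumes "finite S" "a \<in> S"
  shows "card {p. p permutes S \<and> card (orbit p a) \<le> t} = min t (card S) * fact (card S - 1)"
proof -
  let ?A = "\<lambda>d. {p. p permutes S \<and> card (orbit p a) = d}"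
  have fin: "finite (?A d)" for d by (rule finite_subset[OF _ finite_permutations[OF assms(1)]]) auto
  have bounds: "1 \<le> card (orbit p a) \<and> card (orbit p a) \<le> card S" if p: "p permutes S" for p
  proof -
    have "a \<in> orbit p a" using p assms(1) permutation_permutes permutation_self_in_orbit by metis
    moreover have "orbit p a \<subseteq> S" using p assms(2) by (rule permutes_orbit_subset)
    ultimately show ?thesis using assms(1) by (metis One_nat_def Suc_leI card_gt_0_iff card_mono empty_iff finite_subset)
  qed
  have "{p. p permutes S \<and> card (orbit p a) \<le> t} = (\<Union>d\<in>{1..min t (card S)}. ?A d)"
    using bounds by auto
  also have "card \<dots> = (\<Sum>d\<in>{1..min t (card S)}. card (?A d))"
    by (rule card_UN_disjoint) (auto simp: fin)
  also have "\<dots> = (\<Sum>d\<in>{1..min t (card S)}. fact (card S - 1))"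
    using assms by (intro sum.cong card_permutes_orbit) auto
  finally show ?thesis by simp
qed

text \<open>On a finite set, mapping S into S means mapping it onto S, so the complement is
  preserved as well and the permutation is the product of its restrictions to the two
  pieces.\<close>

lemma card_permutes_invariant_le:
  assumes "finite U" "S \<subseteq> U"
  shows "card {p. p permutes U \<and> p ` S \<subseteq> S} \<le> fact (card S) * fact (card U - card S)"
proof -
  let ?P = "{p. p permutes S}" and ?Q = "{q. q permutes (U - S)}"
  have fin: "finite S" using assms by (rule rev_finite_subset)
  have "{p. p permutes U \<and> p ` S \<subseteq> S} \<subseteq> (\<lambda>(p, q). p \<circ> q) ` (?P \<times> ?Q)"
  proof
    fix r assume "r \<in> {p. p permutes U \<and> p ` S \<subseteq> S}"
    then have r: "r permutes U" "r ` S \<subseteq> S" by auto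
    then have rS: "r ` S = S" using fin by (simp add: endo_inj_surj permutes_inj_on)
    have "r ` (U - S) = U - S" using r(1) rS by (simp add: image_set_diff permutes_image permutes_inj)
    then have b: "bij_betw r S S" "bij_betw r (U - S) (U - S)"
      using r(1) rS by (auto simp: bij_betw_def permutes_inj_on)
    have "r = restrict_id r S \<circ> restrict_id r (U - S)"
    proof
      fix x
      show "r x = (restrict_id r S \<circ> restrict_id r (U - S)) x"
        using r(1) bij_betwE[OF b(2)] assms(2)
        by (cases "x \<in> S"; cases "x \<in> U") (auto simp: permutes_not_in restrict_id_def)
    qed
    then show "r \<in> (\<lambda>(p, q). p \<circ> q) ` (?P \<times> ?Q)"
      using permutes_restrict_id[OF b(1)] permutes_restrict_id[OF b(2)]
      by (intro image_eqI[of _ _ "(restrict_id r S, restrict_id r (U - S))"]) auto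
  qed
  then have "card {p. p permutes U \<and> p ` S \<subseteq> S} \<le> card (?P \<times> ?Q)"
    using assms fin by (intro surj_card_le) (auto simp: finite_permutations)
  also have "\<dots> = fact (card S) * fact (card U - card S)"
    using assms fin by (simp add: card_cartesian_product card_permutations card_Diff_subset)
  finally show ?thesis .
qed

section \<open>Estimates for binomial coefficients\<close>

lemma binomial_square_le: "(n choose k)\<^sup>2 \<le> (2 * n) choose (2 * k)"
proof -
  \<comment> \<open>The square is the middle term j = k of the Vandermonde sum for 2n choose
    2k.\<close>
  have "(n choose k) * (n choose (2 * k - k)) \<le> (\<Sum>j\<le>2 * k. (n choose j) * (n choose (2 * k - j)))"
    by (rule member_le_sum) auto
  then show ?thesis by (simp add: vandermonde power2_eq_square mult_2)
qed

text \<open>Binomial coefficients increase up to the middle; beyond it, reflect k to n - k, which is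
  still at least 2.\<close>

lemma binomial_ge_choose_2:
  assumes "2 \<le> k" "k + 2 \<le> n"
  shows "n choose 2 \<le> n choose k"
proof (cases "2 * k \<le> n")
  case True
  then show ?thesis using assms by (intro binomial_mono) auto
next
  case False
  have "n choose 2 \<le> n choose (n - k)" using assms False by (intro binomial_mono) auto
  then show ?thesis using assms binomial_symmetric[of k n] by simp
qed

text \<open>The terms k = 1 and k = n - 1 contribute 1/n each. The other n - 3 terms are at most 1 /
  (n choose 2), of order n^(-2), and together contribute at most 2/n. The cases n = 2 and n = 3 are
  computed directly; for n = 2 the two end terms coincide.\<close>

lemma sum_inverse_binomial_le:
  assumes "n \<ge> 2"
  shows "(\<Sum>k\<in>{0<..<n}. 1 / real (n choose k)) \<le> 4 / real n"
proof -
  have split: "{0<..<n} = {1, n - 1} \<union> {2..n - 2}" if "n \<ge> 4" using that by auto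
  consider "n = 2" | "n = 3" | "n \<ge> 4" using assms by linarith
  then show ?thesis
  proof cases
    case 1
    then have "{0<..<n} = {1}" by auto
    then show ?thesis using 1 by simp
  next
    case 2
    then have "{0<..<n} = {1, 2}" by auto
    then show ?thesis using 2 by (simp add: binomial_symmetric[of 2 3])
  next
    case 3
    have "(\<Sum>k\<in>{0<..<n}. 1 / real (n choose k)) = (\<Sum>k\<in>{1, n - 1}. 1 / real (n choose k)) + (\<Sum>k\<in>{2..n - 2}. 1 / real (n choose k))"
      unfolding split[OF 3] by (rule sum.union_disjoint) (use 3 in auto)
    also have "(\<Sum>k\<in>{1, n - 1}. 1 / real (n choose k)) = 2 / real n"
      using 3 binomial_symmetric[of 1 n] by simp
    also have "(\<Sum>k\<in>{2..n - 2}. 1 / real (n choose k)) \<le> (\<Sum>k\<in>{2..n - 2}. 1 / real (n choose 2))"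
      using 3 by (intro sum_mono divide_left_mono) (auto simp: binomial_ge_choose_2 zero_less_binomial_iff)
    also have "\<dots> = real (n - 3) / real (n choose 2)" using 3 by (simp add: Suc_diff_Suc numeral_3_eq_3 numeral_2_eq_2)
    also have "real (n choose 2) = real n * (real n - 1) / 2"
      using 3 by (simp add: choose_two real_of_nat_div of_nat_diff)
    also have "real (n - 3) / (real n * (real n - 1) / 2) \<le> 2 / real n"
      using 3 by (simp add: field_simps of_nat_diff)
    finally show ?thesis using 3 by (simp add: field_simps)
  qed
qed

section \<open>Rotations acting transitively together with the edge pairing\<close>

text \<open>This is the fixed pairing \<alpha>. It matches 2j with 2j + 1, so the edge of i is
  numbered \<open>i div 2\<close> and unions of edges are preimages under
  \<open>div 2\<close>.\<close>

definition edge_flip :: "nat \<Rightarrow> nat" where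
  "edge_flip i = (if even i then Suc i else i - 1)"

lemma edge_flip_flip [simp]: "edge_flip (edge_flip i) = i"
  and edge_flip_neq [simp]: "edge_flip i \<noteq> i"
  by (auto simp: edge_flip_def elim!: oddE)

lemma edge_flip_less_iff [simp]: "edge_flip i < 2 * n \<longleftrightarrow> i < 2 * n"
  by (auto simp: edge_flip_def elim!: oddE evenE)

lemma div_2_eq_iff: "i div 2 = j div 2 \<longleftrightarrow> j = i \<or> j = edge_flip i"
  by (auto simp: edge_flip_def elim!: oddE evenE)

lemma card_vimage_div_2:
  assumes "finite T"
  shows "finite {i::nat. i div 2 \<in> T}" "card {i::nat. i div 2 \<in> T} = 2 * card T"
proof -
  let ?f = "\<lambda>(t, e). 2 * t + e :: nat"
  have "{i::nat. i div 2 \<in> T} = ?f ` (T \<times> {0, 1})" (is "?A = ?B")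
  proof (intro equalityI subsetI)
    fix i assume "i \<in> ?A"
    then show "i \<in> ?B" by (intro image_eqI[of _ _ "(i div 2, i mod 2)"]) auto
  qed auto
  moreover have "inj_on ?f (T \<times> {0, 1})" by (auto simp: inj_on_def) presburger+
  ultimately show "finite {i::nat. i div 2 \<in> T}" "card {i::nat. i div 2 \<in> T} = 2 * card T"
    using assms by (simp_all add: card_image card_cartesian_product)
qed

text \<open>Transitivity is stated as the absence of a proper invariant set containing the root
  half-edge 0. On a finite set, forward invariance under a permutation already gives invariance
  under its inverse, so this is transitivity of the generated group. The form suits both the union
  bound and the arguments by connectedness.\<close>

definition transitive_rotations :: "nat \<Rightarrow> (nat \<Rightarrow> nat) set" where
  "transitive_rotations n = {\<sigma>. \<sigma> permutes {..<2 * n} \<and>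
     (\<forall>S \<subseteq> {..<2 * n}. 0 \<in> S \<longrightarrow> \<sigma> ` S \<subseteq> S \<longrightarrow> edge_flip ` S \<subseteq> S \<longrightarrow> S = {..<2 * n})}"

lemma card_not_transitive_le:
  assumes "n \<ge> 2"
  shows "real (card ({\<sigma>. \<sigma> permutes {..<2 * n}} - transitive_rotations n)) \<le> 4 / real n * fact (2 * n)"
proof -
  let ?U = "{..<2 * n}"
  let ?D = "\<lambda>T. {i::nat. i div 2 \<in> T}"
  let ?P = "\<lambda>T. {\<sigma>. \<sigma> permutes ?U \<and> \<sigma> ` ?D T \<subseteq> ?D T}"
  let ?I = "{T. T \<subseteq> {..<n} \<and> card T \<in> {0<..<n}}"
  let ?f = "\<lambda>k. fact (2 * k) * fact (2 * n - 2 * k) :: real"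
  have finI: "finite ?I" by (rule finite_subset[of _ "Pow {..<n}"]) auto
  have finP: "finite (?P T)" for T by (rule finite_subset[OF _ finite_permutations[of ?U]]) auto
  have "{\<sigma>. \<sigma> permutes ?U} - transitive_rotations n \<subseteq> (\<Union>T\<in>?I. ?P T)"
  proof
    fix \<sigma> assume "\<sigma> \<in> {\<sigma>. \<sigma> permutes ?U} - transitive_rotations n"
    then obtain S where \<sigma>: "\<sigma> permutes ?U" and S: "S \<subseteq> ?U" "0 \<in> S" "\<sigma> ` S \<subseteq> S" "edge_flip ` S \<subseteq> S" "S \<noteq> ?U"
      by (auto simp: transitive_rotations_def)
    define T where "T = (\<lambda>i. i div 2) ` S"
    \<comment> \<open>Closure under \<open>edge_flip\<close> makes S a union of whole edges, so S is
      encoded by its set T of edge numbers and the union bound runs over subsets of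
      \<open>{..<n}\<close>.\<close>
    have D: "?D T = S"
    proof (intro equalityI subsetI)
      fix i assume "i \<in> ?D T"
      then obtain j where "j \<in> S" "i div 2 = j div 2" by (auto simp: T_def)
      then show "i \<in> S" using S(4) div_2_eq_iff[of j i] by auto
    qed (auto simp: T_def)
    have T: "T \<subseteq> {..<n}" "T \<noteq> {}" using S by (auto simp: T_def)
    moreover have "T \<noteq> {..<n}"
    proof
      assume "T = {..<n}"
      then have "?D T = ?U" by auto
      with D S show False by simp
    qed
    ultimately have "T \<subset> {..<n}" "finite T" by (auto intro: finite_subset)
    then have "card T \<in> {0<..<n}" using psubset_card_mono[of "{..<n}" T] \<open>T \<noteq> {}\<close> by (simp add: card_gt_0_iff)
    then show "\<sigma> \<in> (\<Union>T\<in>?I. ?P T)" using T \<sigma> D S(3) by auto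
  qed
  then have "card ({\<sigma>. \<sigma> permutes ?U} - transitive_rotations n) \<le> card (\<Union>T\<in>?I. ?P T)"
    using finI finP by (intro card_mono) auto
  also have "\<dots> \<le> (\<Sum>T\<in>?I. card (?P T))" using finI by (rule card_UN_le)
  also have "\<dots> \<le> (\<Sum>T\<in>?I. fact (2 * card T) * fact (2 * n - 2 * card T))"
  proof (rule sum_mono)
    fix T assume "T \<in> ?I"
    then have T: "T \<subseteq> {..<n}" by simp
    then have "finite T" by (rule finite_subset) simp
    moreover have "?D T \<subseteq> ?U" using T by auto
    ultimately show "card (?P T) \<le> fact (2 * card T) * fact (2 * n - 2 * card T)"
      using card_permutes_invariant_le[of ?U "?D T"] by (simp add: card_vimage_div_2)
  qed
  finally have "real (card ({\<sigma>. \<sigma> permutes ?U} - transitive_rotations n))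
      \<le> real (\<Sum>T\<in>?I. fact (2 * card T) * fact (2 * n - 2 * card T))"
    by (rule of_nat_mono)
  also have "\<dots> = (\<Sum>T\<in>?I. ?f (card T))" by simp
  \<comment> \<open>The bound depends only on the number k of edges in T, and there are n choose k
    sets T of that size.\<close>
  also have "\<dots> = (\<Sum>k\<in>{0<..<n}. \<Sum>T\<in>{T \<in> ?I. card T = k}. ?f (card T))"
    using finI by (intro sum.group[symmetric]) auto
  also have "\<dots> = (\<Sum>k\<in>{0<..<n}. real (n choose k) * ?f k)"
  proof (rule sum.cong[OF refl])
    fix k assume "k \<in> {0<..<n}"
    then have "{T \<in> ?I. card T = k} = {T. T \<subseteq> {..<n} \<and> card T = k}" by auto
    then show "(\<Sum>T\<in>{T \<in> ?I. card T = k}. ?f (card T)) = real (n choose k) * ?f k"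
      by (simp add: n_subsets)
  qed
  also have "\<dots> \<le> (\<Sum>k\<in>{0<..<n}. fact (2 * n) * (1 / real (n choose k)))"
  proof (rule sum_mono)
    fix k assume k: "k \<in> {0<..<n}"
    have "?f k * real ((2 * n) choose (2 * k)) = fact (2 * n)"
      using k by (subst binomial_fact) auto
    moreover have "real ((n choose k)\<^sup>2) \<le> real ((2 * n) choose (2 * k))"
      by (rule of_nat_mono) (rule binomial_square_le)
    ultimately have "?f k * (real (n choose k))\<^sup>2 \<le> fact (2 * n)"
      by (metis mult_left_mono of_nat_power zero_le_mult_iff fact_ge_zero)
    then show "real (n choose k) * ?f k \<le> fact (2 * n) * (1 / real (n choose k))"
      using k by (simp add: field_simps power2_eq_square)
  qed
  also have "\<dots> = fact (2 * n) * (\<Sum>k\<in>{0<..<n}. 1 / real (n choose k))"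
    by (rule sum_distrib_left[symmetric])
  also have "\<dots> \<le> fact (2 * n) * (4 / real n)"
    by (rule mult_left_mono[OF sum_inverse_binomial_le[OF assms]]) simp
  finally show ?thesis by (simp add: mult.commute)
qed

section \<open>Isomorphisms of rooted maps on half-edges\<close>

text \<open>The description is meaningful when the root corner has the form \<open>After a\<close>.
  This holds as soon as the map has an edge, since connectedness then excludes isolated
  vertices.\<close>

definition root_arc :: "('v, 'h) rooted_map \<Rightarrow> 'h" where
  "root_arc M = (THE a. root_corner M = After a)"

locale nonempty_rooted_map =
  fixes M :: "('v, 'h) rooted_map"
  assumes rooted: "is_rooted_map M" and edges_nonempty: "edges M \<noteq> {}"
begin

abbreviation "G \<equiv> underlying M"

sublocale fin_digraph G
  using rooted by (simp add: is_rooted_map_def is_cmap_def)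

sublocale bidirected_digraph G "opp M"
  using rooted by (simp add: is_rooted_map_def is_cmap_def)

lemma rot_permutes: "rot M permutes arcs G"
  using rooted by (simp add: is_rooted_map_def is_cmap_def)

lemma reachable_verts:
  assumes "u \<in> verts G" "v \<in> verts G"
  shows "u \<rightarrow>\<^sup>*\<^bsub>G\<^esub> v"
proof -
  have "strongly_connected (with_proj (mk_symmetric G))"
    using rooted by (simp add: is_rooted_map_def is_cmap_def connected_def)
  then have "u \<rightarrow>\<^sup>*\<^bsub>with_proj (mk_symmetric G)\<^esub> v"
    using assms by (auto simp: strongly_connected_def)
  then show ?thesis using reachable_mk_symmetric_eq[OF sym_arcs] by blast
qed

text \<open>A walk from v to the tail of some given arc either is trivial or leaves v through an
  arc.\<close>

lemma out_arcs_nonempty: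
  assumes "v \<in> verts G"
  shows "out_arcs G v \<noteq> {}"
proof -
  obtain a where a: "a \<in> arcs G" using edges_nonempty by (auto simp: edges_def)
  show ?thesis
  proof (cases "tail G a = v")
    case True
    with a show ?thesis by auto
  next
    case False
    have "v \<rightarrow>\<^sup>*\<^bsub>G\<^esub> tail G a" using assms a by (intro reachable_verts) auto
    then show ?thesis
    proof (cases rule: converse_reachable_cases)
      case base
      with False show ?thesis by simp
    next
      case (step w)
      then show ?thesis by (auto simp: arcs_ends_def arc_to_ends_def)
    qed
  qed
qed

lemma verts_eq: "verts G = tail G ` arcs G"
proof
  show "verts G \<subseteq> tail G ` arcs G"
  proof
    fix v assume "v \<in> verts G"
    then obtain a where "a \<in> out_arcs G v" using out_arcs_nonempty by blast
    then show "v \<in> tail G ` arcs G" by auto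
  qed
qed auto

text \<open>This identifies the vertices with the cycles of \<open>rot\<close>; the cyclicity
  condition of \<open>is_cmap\<close> applies because every vertex has a half-edge.\<close>

lemma orbit_rot:
  assumes "a \<in> arcs G"
  shows "orbit (rot M) a = out_arcs G (tail G a)"
proof -
  have "tail G a \<in> verts G" using assms by simp
  then have "cyclic_on (rot M) (out_arcs G (tail G a))"
    using rooted out_arcs_nonempty by (auto simp: is_rooted_map_def is_cmap_def)
  then show ?thesis using assms by (simp add: cyclic_on_alldef)
qed

text \<open>Connectedness in terms of half-edges: \<open>rot\<close> sweeps out all half-edges at a
  vertex and \<open>opp\<close> crosses to the neighbouring vertex, so S spreads along every
  walk.\<close>

lemma invariant_set_eq_arcs:
  assumes S: "S \<subseteq> arcs G" "a \<in> S" and rot: "rot M ` S \<subseteq> S" and opp: "opp M ` S \<subseteq> S"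
  shows "S = arcs G"
proof -
  have orb: "out_arcs G (tail G b) \<subseteq> S" if "b \<in> S" for b
  proof -
    have "x \<in> S" if "x \<in> orbit (rot M) b" for x
      using that by induct (use rot \<open>b \<in> S\<close> in auto)
    then show ?thesis using orbit_rot[of b] that S(1) by auto
  qed
  have "out_arcs G v \<subseteq> S" if "tail G a \<rightarrow>\<^sup>*\<^bsub>G\<^esub> v" for v
    using that
  proof (induct rule: reachable_induct)
    case base
    show ?case using orb S(2) by blast
  next
    case (step u v)
    then obtain b where b: "b \<in> arcs G" "tail G b = u" "head G b = v"
      by (auto simp: arcs_ends_def arc_to_ends_def)
    then have "b \<in> S" using step by auto
    then have "opp M b \<in> S" using opp by blast
    then show ?case using orb[of "opp M b"] b by simp
  qed
  then have "b \<in> S" if "b \<in> arcs G" for b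
    using reachable_verts[of "tail G a" "tail G b"] that S by fastforce
  then show ?thesis using S by blast
qed

lemma root_corner_eq: "root_corner M = After (root_arc M)"
  and root_arc_in_arcs [simp]: "root_arc M \<in> arcs G"
proof -
  have "root_corner M \<in> corners M" using rooted by (simp add: is_rooted_map_def)
  then obtain a where "root_corner M = After a" "a \<in> arcs G"
    using out_arcs_nonempty by (auto simp: corners_def)
  then show "root_corner M = After (root_arc M)" "root_arc M \<in> arcs G"
    by (simp_all add: root_arc_def)
qed

lemma root_degree_eq: "root_degree M = card (orbit (rot M) (root_arc M))"
  by (simp add: root_degree_def root_corner_eq orbit_rot out_degree_def)

end

text \<open>Vertices do not appear, because they are recovered as cycles of
  \<open>rot\<close>.\<close>

definition half_edge_iso :: "('h \<Rightarrow> 'k) \<Rightarrow> ('v, 'h) rooted_map \<Rightarrow> ('w, 'k) rooted_map \<Rightarrow> bool" where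
  "half_edge_iso h M N \<longleftrightarrow>
     bij_betw h (arcs (underlying M)) (arcs (underlying N)) \<and>
     (\<forall>a \<in> arcs (underlying M). h (opp M a) = opp N (h a) \<and> h (rot M a) = rot N (h a)) \<and>
     h (root_arc M) = root_arc N"

lemma (in nonempty_rooted_map) half_edge_iso_id: "half_edge_iso id M M"
  by (simp add: half_edge_iso_def)

lemma (in nonempty_rooted_map) half_edge_iso_inv:
  assumes "half_edge_iso h M N"
  shows "half_edge_iso (inv_into (arcs G) h) N M"
proof -
  let ?g = "inv_into (arcs G) h"
  have b: "bij_betw h (arcs G) (arcs (underlying N))" using assms by (simp add: half_edge_iso_def)
  have g: "?g (h a) = a" if "a \<in> arcs G" for a using b that by (rule bij_betw_inv_into_left)
  have "?g (opp N c) = opp M (?g c) \<and> ?g (rot N c) = rot M (?g c)" if c: "c \<in> arcs (underlying N)" for c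
  proof -
    obtain a where a: "a \<in> arcs G" "c = h a" using b c by (auto simp: bij_betw_def)
    then have "opp N c = h (opp M a)" "rot N c = h (rot M a)"
      using assms by (simp_all add: half_edge_iso_def)
    moreover have "rot M a \<in> arcs G" using a rot_permutes by (simp add: permutes_in_image)
    ultimately show ?thesis using a by (simp add: g)
  qed
  moreover have "?g (root_arc N) = root_arc M"
    using assms g[of "root_arc M"] by (simp add: half_edge_iso_def)
  ultimately show ?thesis
    using bij_betw_inv_into[OF b] by (simp add: half_edge_iso_def)
qed

lemma half_edge_iso_trans:
  assumes "half_edge_iso h M N" "half_edge_iso k N L"
  shows "half_edge_iso (k \<circ> h) M L"
  using assms bij_betw_trans[of h "arcs (underlying M)" "arcs (underlying N)" k "arcs (underlying L)"]
  by (auto simp: half_edge_iso_def dest: bij_betwE)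

text \<open>It serves twice: to define the action of a half-edge bijection on vertices, and to carry
  the root degree along an isomorphism.\<close>

lemma (in nonempty_rooted_map) half_edge_iso_orbit:
  assumes "half_edge_iso h M N" "a \<in> arcs G"
  shows "h ` orbit (rot M) a = orbit (rot N) (h a)"
proof -
  have h: "h (rot M b) = rot N (h b)" if "b \<in> arcs G" for b
    using assms that by (simp add: half_edge_iso_def)
  have arc: "b \<in> arcs G" if "b \<in> orbit (rot M) a" for b
    using that assms(2) by (simp add: orbit_rot)
  have "h b \<in> orbit (rot N) (h a)" if "b \<in> orbit (rot M) a" for b
    using that
  proof induct
    case base
    show ?case using orbit.base[of "rot N" "h a"] assms(2) by (simp add: h)
  next
    case (step b)
    then show ?case using orbit.step[OF step(2)] arc[OF step(1)] by (simp add: h)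
  qed
  moreover have "c \<in> h ` orbit (rot M) a" if "c \<in> orbit (rot N) (h a)" for c
    using that
  proof induct
    case base
    show ?case using assms(2) orbit.base[of "rot M" a] by (metis h image_eqI)
  next
    case (step c)
    then obtain b where b: "c = h b" "b \<in> orbit (rot M) a" by auto
    then have "rot N c = h (rot M b)" using arc by (simp add: h)
    then show ?case using orbit.step[OF b(2)] by blast
  qed
  ultimately show ?thesis by auto
qed

lemma rooted_map_iso_iff_half_edge_iso:
  assumes "nonempty_rooted_map M" "nonempty_rooted_map N"
  shows "rooted_map_iso M N \<longleftrightarrow> (\<exists>h. half_edge_iso h M N)"
proof -
  interpret M: nonempty_rooted_map M by fact
  interpret N: nonempty_rooted_map N by fact
  show ?thesis
  proof
    assume "rooted_map_iso M N"
    then obtain f where f: "M.digraph_isomorphism f" "underlying N = app_iso f M.G"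
      "\<forall>a \<in> arcs M.G. opp N (iso_arcs f a) = iso_arcs f (opp M a)"
      "\<forall>a \<in> arcs M.G. rot N (iso_arcs f a) = iso_arcs f (rot M a)"
      "root_corner N = map_corner (iso_verts f) (iso_arcs f) (root_corner M)"
      unfolding rooted_map_iso_def by blast
    have "bij_betw (iso_arcs f) (arcs M.G) (arcs N.G)"
      using f(1,2) by (auto simp: bij_betw_def M.digraph_isomorphism_def)
    moreover have "iso_arcs f (root_arc M) = root_arc N"
      using f(5) by (simp add: M.root_corner_eq N.root_corner_eq)
    ultimately have "half_edge_iso (iso_arcs f) M N" using f by (simp add: half_edge_iso_def)
    then show "\<exists>h. half_edge_iso h M N" by blast
  next
    assume "\<exists>h. half_edge_iso h M N"
    then obtain h where h: "half_edge_iso h M N" ..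
    then have b: "bij_betw h (arcs M.G) (arcs N.G)"
      and comm: "\<And>a. a \<in> arcs M.G \<Longrightarrow> opp N (h a) = h (opp M a) \<and> rot N (h a) = h (rot M a)"
      by (simp_all add: half_edge_iso_def)
    then have hin: "h a \<in> arcs N.G" if "a \<in> arcs M.G" for a using that bij_betwE by blast
    \<comment> \<open>The vertex map follows any half-edge at v. The choice is harmless, since h
      carries the half-edges at one vertex onto the half-edges at one vertex.\<close>
    define \<phi> where "\<phi> v = tail N.G (h (SOME a. a \<in> out_arcs M.G v))" for v
    have out: "h ` out_arcs M.G (tail M.G a) = out_arcs N.G (tail N.G (h a))" if "a \<in> arcs M.G" for a
      using M.half_edge_iso_orbit[OF h that] that hin by (simp add: M.orbit_rot N.orbit_rot)
    have \<phi>: "\<phi> (tail M.G a) = tail N.G (h a)" if "a \<in> arcs M.G" for a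
    proof -
      have "(SOME b. b \<in> out_arcs M.G (tail M.G a)) \<in> out_arcs M.G (tail M.G a)"
        by (rule someI[of _ a]) (simp add: that)
      then have "h (SOME b. b \<in> out_arcs M.G (tail M.G a)) \<in> out_arcs N.G (tail N.G (h a))"
        using out[OF that] by blast
      then show ?thesis by (simp add: \<phi>_def)
    qed
    \<comment> \<open>\<open>app_iso\<close> copies its head and tail functions from the isomorphism
      record. Taking those of N gives equality of the digraphs as records, including values off the
      arcs.\<close>
    define f where "f = \<lparr>iso_verts = \<phi>, iso_arcs = h, iso_head = head N.G, iso_tail = tail N.G\<rparr>"
    have "inj_on \<phi> (verts M.G)"
    proof (rule inj_onI)
      fix u v assume uv: "u \<in> verts M.G" "v \<in> verts M.G" "\<phi> u = \<phi> v"
      then obtain a c where ac: "a \<in> arcs M.G" "u = tail M.G a" "c \<in> arcs M.G" "v = tail M.G c"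
        by (auto simp: M.verts_eq)
      then have "tail N.G (h a) = tail N.G (h c)" using uv by (simp add: \<phi>)
      then have "h c \<in> h ` out_arcs M.G (tail M.G a)" using ac hin by (simp add: out)
      then have "c \<in> out_arcs M.G (tail M.G a)"
        using b ac by (auto simp: bij_betw_def dest: inj_onD)
      then show "u = v" using ac by simp
    qed
    \<comment> \<open>The head of an arc is the tail of its opposite, so heads reduce to
      tails.\<close>
    moreover have "\<phi> (head M.G a) = head N.G (h a)" if "a \<in> arcs M.G" for a
      using \<phi>[of "opp M a"] that comm[OF that] hin N.tail_arev[of "h a"] by simp
    ultimately have iso: "M.digraph_isomorphism f"
      using b \<phi> M.wf_digraph_axioms by (auto simp: M.digraph_isomorphism_def f_def bij_betw_def)
    have "verts N.G = \<phi> ` verts M.G"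
      unfolding M.verts_eq N.verts_eq bij_betw_imp_surj_on[OF b, symmetric] image_image
      using \<phi> by (intro image_cong) auto
    moreover have "arcs N.G = h ` arcs M.G" using b by (simp add: bij_betw_def)
    ultimately have "underlying N = app_iso f M.G"
      by (simp add: app_iso_def f_def)
    moreover have "root_corner N = map_corner (iso_verts f) (iso_arcs f) (root_corner M)"
      using h by (simp add: M.root_corner_eq N.root_corner_eq f_def half_edge_iso_def)
    ultimately show "rooted_map_iso M N"
      using iso comm unfolding rooted_map_iso_def by (intro exI[of _ f]) (auto simp: f_def)
  qed
qed

section \<open>Labelled rooted maps\<close>

lemma (in nonempty_rooted_map) card_arcs: "card (arcs G) = 2 * card (edges M)"
proof -
  have "card (\<Union>(edges M)) = (\<Sum>e\<in>edges M. card e)"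
    by (rule card_Union_disjoint) (auto simp: edges_def pairwise_def disjnt_def arev_eq_iff)
  also have "\<Union>(edges M) = arcs G" by (auto simp: edges_def)
  also have "(\<Sum>e\<in>edges M. card e) = (\<Sum>e\<in>edges M. 2)"
    using arev_neq by (intro sum.cong) (fastforce simp: edges_def)+
  finally show ?thesis by simp
qed

text \<open>Number the edges with the root edge first, and in each edge give the even label to a
  chosen representative, which in the root edge is the root.\<close>

lemma (in nonempty_rooted_map) ex_labelling:
  assumes n: "card (edges M) = n"
  shows "\<exists>h. bij_betw h (arcs G) {..<2 * n} \<and> (\<forall>a \<in> arcs G. h (opp M a) = edge_flip (h a)) \<and>
    h (root_arc M) = 0"
proof -
  let ?edge = "\<lambda>a. {a, opp M a}"
  let ?r = "root_arc M"
  have edge_eq: "?edge a = ?edge b \<longleftrightarrow> b = a \<or> b = opp M a" for a b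
    using arev_arev by (auto simp: doubleton_eq_iff)
  have fin: "finite (edges M)" by (simp add: edges_def)
  have r: "?edge ?r \<in> edges M" by (auto simp: edges_def)
  have npos: "n > 0" using n fin r by (auto simp: card_gt_0_iff)
  obtain e0 where e0: "bij_betw e0 (edges M) {..<n}"
    using ex_bij_betw_finite_nat[OF fin] n by (auto simp: atLeast0LessThan)
  \<comment> \<open>The transposition moves the number of the root edge to 0.\<close>
  define e where "e = Transposition.transpose (e0 (?edge ?r)) 0 \<circ> e0"
  have "e0 (?edge ?r) < n" using e0 r bij_betwE by blast
  then have "Transposition.transpose (e0 (?edge ?r)) 0 permutes {..<n}"
    using npos by (intro permutes_swap_id) auto
  then have e: "bij_betw e (edges M) {..<n}"
    unfolding e_def using bij_betw_trans[OF e0 permutes_imp_bij] by blast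
  have er: "e (?edge ?r) = 0" by (simp add: e_def)
  \<comment> \<open>\<open>rep\<close> depends only on the edge as a set, so both halves see the
    same representative and exactly one of them gets the even label.\<close>
  define rep where "rep E = (if ?r \<in> E then ?r else SOME a. a \<in> E)" for E
  have rep_mem: "rep (?edge a) \<in> ?edge a" for a
    unfolding rep_def using someI[of "\<lambda>x. x \<in> ?edge a" a] by auto
  define h where "h a = 2 * e (?edge a) + (if rep (?edge a) = a then 0 else 1)" for a
  have hdiv: "h a div 2 = e (?edge a)" for a by (simp add: h_def)
  have hr: "h ?r = 0" by (simp add: h_def er rep_def)
  have hopp: "h (opp M a) = edge_flip (h a)" if a: "a \<in> arcs G" for a
  proof -
    have E: "?edge (opp M a) = ?edge a" by (simp add: insert_commute)
    show ?thesis
      using rep_mem[of a] arev_neq[OF a]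
      unfolding h_def E by (auto simp: edge_flip_def)
  qed
  have inj: "inj_on h (arcs G)"
  proof (rule inj_onI)
    fix a b assume ab: "a \<in> arcs G" "b \<in> arcs G" "h a = h b"
    then have "e (?edge a) = e (?edge b)" by (metis hdiv)
    then have "?edge a = ?edge b" using e ab by (auto simp: bij_betw_def edges_def dest: inj_onD)
    then consider "b = a" | "b = opp M a" using edge_eq by blast
    then show "a = b" using ab hopp[of a] edge_flip_neq[of "h a"] by cases metis+
  qed
  have "h ` arcs G \<subseteq> {..<2 * n}"
  proof (rule image_subsetI)
    fix a assume "a \<in> arcs G"
    then have "e (?edge a) < n" using e bij_betwE unfolding edges_def by blast
    then show "h a \<in> {..<2 * n}" by (simp add: h_def)
  qed
  moreover have "card (h ` arcs G) = card {..<2 * n}" using inj n by (simp add: card_image card_arcs)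
  ultimately have "h ` arcs G = {..<2 * n}" by (intro card_subset_eq) auto
  then show ?thesis using inj hopp hr by (auto simp: bij_betw_def)
qed

text \<open>Each vertex is named by the least half-edge of its cycle, which keeps vertices natural
  numbers. \<open>opp\<close> is cut off to the identity outside the arcs, as a bidirected digraph
  demands; \<open>edge_flip\<close> itself has no fixed point.\<close>

definition labelled_map :: "nat \<Rightarrow> (nat \<Rightarrow> nat) \<Rightarrow> (nat, nat) rooted_map" where
  "labelled_map n \<sigma> =
     \<lparr>underlying = \<lparr>verts = (\<lambda>i. Min (orbit \<sigma> i)) ` {..<2 * n}, arcs = {..<2 * n},
        tail = \<lambda>i. Min (orbit \<sigma> i), head = \<lambda>i. Min (orbit \<sigma> (edge_flip i))\<rparr>,
      opp = \<lambda>i. if i < 2 * n then edge_flip i else i, rot = \<sigma>, root_corner = After 0\<rparr>"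

lemma labelled_map_simps [simp]:
  "arcs (underlying (labelled_map n \<sigma>)) = {..<2 * n}"
  "i < 2 * n \<Longrightarrow> opp (labelled_map n \<sigma>) i = edge_flip i"
  "rot (labelled_map n \<sigma>) = \<sigma>"
  "root_arc (labelled_map n \<sigma>) = 0"
  by (simp_all add: labelled_map_def root_arc_def)

lemma transitive_rotationsD:
  assumes "\<sigma> \<in> transitive_rotations n"
  shows "\<sigma> permutes {..<2 * n}"
    and "S \<subseteq> {..<2 * n} \<Longrightarrow> 0 \<in> S \<Longrightarrow> \<sigma> ` S \<subseteq> S \<Longrightarrow> edge_flip ` S \<subseteq> S \<Longrightarrow> S = {..<2 * n}"
  using assms by (auto simp: transitive_rotations_def)

lemma finite_transitive_rotations: "finite (transitive_rotations n)"
  by (rule finite_subset[OF _ finite_permutations[of "{..<2 * n}"]]) (auto simp: transitive_rotations_def)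

lemma labelled_map_in_rooted_maps:
  assumes "n > 0" and \<sigma>: "\<sigma> \<in> transitive_rotations n"
  shows "labelled_map n \<sigma> \<in> rooted_maps n"
proof -
  let ?M = "labelled_map n \<sigma>" and ?G = "underlying (labelled_map n \<sigma>)" and ?U = "{..<2 * n}"
  have p: "\<sigma> permutes ?U" using \<sigma> by (rule transitive_rotationsD)
  then have perm: "permutation \<sigma>" using permutation_permutes by blast
  have self: "i \<in> orbit \<sigma> i" for i using perm by (rule permutation_self_in_orbit)
  have fin: "finite (orbit \<sigma> i)" for i using self by (rule finite_orbit)
  have cyc: "cyclic_on \<sigma> (orbit \<sigma> i)" for i using perm by (rule cyclic_on_orbit')
  have sub: "orbit \<sigma> i \<subseteq> ?U" if "i < 2 * n" for i using p that by (simp add: permutes_orbit_subset)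
  have tail: "tail ?G = (\<lambda>i. Min (orbit \<sigma> i))" and head: "head ?G = (\<lambda>i. Min (orbit \<sigma> (edge_flip i)))"
    and verts: "verts ?G = (\<lambda>i. Min (orbit \<sigma> i)) ` ?U"
    by (simp_all add: labelled_map_def)
  \<comment> \<open>The minimum lies in its orbit, so orbits with equal minima share an element and
    coincide.\<close>
  have Min_eq: "Min (orbit \<sigma> i) = Min (orbit \<sigma> j) \<longleftrightarrow> orbit \<sigma> i = orbit \<sigma> j" for i j
  proof
    assume eq: "Min (orbit \<sigma> i) = Min (orbit \<sigma> j)"
    have "Min (orbit \<sigma> k) \<in> orbit \<sigma> k" for k using fin self by (intro Min_in) auto
    then show "orbit \<sigma> i = orbit \<sigma> j" using eq cyc by (metis orbit_cyclic_eq3)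
  qed simp
  have out: "out_arcs ?G (tail ?G i) = orbit \<sigma> i" if "i < 2 * n" for i
  proof -
    have "out_arcs ?G (tail ?G i) = {j \<in> ?U. orbit \<sigma> j = orbit \<sigma> i}"
      by (auto simp: out_arcs_def tail Min_eq)
    also have "\<dots> = orbit \<sigma> i"
      using sub[OF that] self orbit_cyclic_eq3[OF cyc] by blast
    finally show ?thesis .
  qed
  interpret fin_digraph ?G
    by unfold_locales (auto simp: tail head verts)
  interpret bidirected_digraph ?G "opp ?M"
    by unfold_locales (auto simp: tail head labelled_map_def)
  have reach: "tail ?G 0 \<rightarrow>\<^sup>*\<^bsub>?G\<^esub> tail ?G i" if "i < 2 * n" for i
  proof -
    \<comment> \<open>The half-edges whose vertex is reachable from the root vertex form an
      invariant set: \<sigma> stays at the vertex and \<open>edge_flip\<close> follows an arc.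
      Transitivity thus yields connectedness.\<close>
    define S where "S = {i \<in> ?U. tail ?G 0 \<rightarrow>\<^sup>*\<^bsub>?G\<^esub> tail ?G i}"
    have "tail ?G (\<sigma> i) = tail ?G i" for i
      unfolding tail Min_eq by (rule orbit_cyclic_eq3[OF cyc orbit.base])
    then have "\<sigma> ` S \<subseteq> S" using permutes_in_image[OF p] by (auto simp: S_def)
    moreover have "edge_flip ` S \<subseteq> S"
    proof (rule image_subsetI)
      fix i assume i: "i \<in> S"
      then have "tail ?G i \<rightarrow>\<^bsub>?G\<^esub> head ?G i" by (intro in_arcs_imp_in_arcs_ends) (auto simp: S_def)
      moreover have "head ?G i = tail ?G (edge_flip i)" by (simp add: tail head)
      ultimately show "edge_flip i \<in> S" using i by (auto simp: S_def intro: reachable_adj_trans)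
    qed
    moreover have "0 \<in> S" using assms(1) by (auto simp: S_def verts tail)
    moreover have "S \<subseteq> ?U" by (auto simp: S_def)
    ultimately have "S = ?U" by (intro transitive_rotationsD(2)[OF \<sigma>])
    then have "i \<in> S" using that by simp
    then show ?thesis by (simp add: S_def)
  qed
  have "strongly_connected (with_proj (mk_symmetric ?G))"
  proof
    show "verts (with_proj (mk_symmetric ?G)) \<noteq> {}"
      using assms(1) by (auto simp: verts lessThan_empty_iff)
  next
    fix u v assume "u \<in> verts (with_proj (mk_symmetric ?G))" "v \<in> verts (with_proj (mk_symmetric ?G))"
    then obtain i j where ij: "i < 2 * n" "j < 2 * n" "u = tail ?G i" "v = tail ?G j" by (auto simp: verts tail)
    have "u \<rightarrow>\<^sup>*\<^bsub>?G\<^esub> tail ?G 0" using symmetric_reachable[OF sym_arcs reach[OF ij(1)]] ij by simp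
    also have "tail ?G 0 \<rightarrow>\<^sup>*\<^bsub>?G\<^esub> v" using reach[OF ij(2)] ij by simp
    finally show "u \<rightarrow>\<^sup>*\<^bsub>with_proj (mk_symmetric ?G)\<^esub> v" by (rule reachable_mk_symmetricI)
  qed
  then have "connected ?G" by (simp add: connected_def)
  moreover have "cyclic_on \<sigma> (out_arcs ?G v)" if v: "v \<in> verts ?G" for v
  proof -
    obtain i where "i < 2 * n" "v = tail ?G i" using v by (auto simp: verts tail)
    then show ?thesis using out cyc by simp
  qed
  ultimately have "is_cmap ?M"
    using p fin_digraph_axioms bidirected_digraph by (simp add: is_cmap_def)
  moreover have "root_corner ?M \<in> corners ?M"
    using assms(1) by (auto simp: corners_def labelled_map_def)
  ultimately have rooted: "is_rooted_map ?M" by (simp add: is_rooted_map_def)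
  have "edges ?M \<noteq> {}" using assms(1) by (auto simp: edges_def lessThan_empty_iff)
  with rooted interpret nonempty_rooted_map ?M by unfold_locales
  have "card (edges ?M) = n" using card_arcs by simp
  with rooted show ?thesis by (simp add: rooted_maps_def)
qed

lemma nonempty_rooted_mapI:
  assumes "n > 0" "M \<in> rooted_maps n"
  shows "nonempty_rooted_map M"
  using assms by (auto simp: rooted_maps_def nonempty_rooted_map_def)

text \<open>Transport \<open>rot\<close> along a labelling. An invariant set of labels pulls back to
  a set of half-edges closed under \<open>rot\<close> and \<open>opp\<close>, to which connectedness
  applies.\<close>

lemma ex_labelled_map:
  assumes "n > 0" "M \<in> rooted_maps n"
  shows "\<exists>\<sigma> \<in> transitive_rotations n. rooted_map_iso M (labelled_map n \<sigma>)"
proof -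
  interpret nonempty_rooted_map M using assms by (rule nonempty_rooted_mapI)
  obtain h where h: "bij_betw h (arcs G) {..<2 * n}"
    "\<And>a. a \<in> arcs G \<Longrightarrow> h (opp M a) = edge_flip (h a)" "h (root_arc M) = 0"
    using ex_labelling assms by (auto simp: rooted_maps_def)
  have inj: "inj_on h (arcs G)" using h by (simp add: bij_betw_def)
  define \<sigma> where "\<sigma> = map_permutation (arcs G) h (rot M)"
  have \<sigma>h: "\<sigma> (h a) = h (rot M a)" if "a \<in> arcs G" for a
    unfolding \<sigma>_def using inj that by (rule map_permutation_apply)
  have p: "\<sigma> permutes {..<2 * n}"
    unfolding \<sigma>_def using h(1) rot_permutes by (rule map_permutation_permutes)
  have "S = {..<2 * n}" if S: "S \<subseteq> {..<2 * n}" "0 \<in> S" "\<sigma> ` S \<subseteq> S" "edge_flip ` S \<subseteq> S" for S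
  proof -
    let ?S = "{a \<in> arcs G. h a \<in> S}"
    have "rot M ` ?S \<subseteq> ?S"
    proof (rule image_subsetI)
      fix a assume a: "a \<in> ?S"
      then have "h (rot M a) \<in> S" using \<sigma>h[of a] S(3) by auto
      then show "rot M a \<in> ?S" using a rot_permutes by (simp add: permutes_in_image)
    qed
    moreover have "opp M ` ?S \<subseteq> ?S" using h(2) S(4) by auto
    ultimately have "?S = arcs G" using S(2) h(3) by (intro invariant_set_eq_arcs[of _ "root_arc M"]) auto
    then have "h ` arcs G \<subseteq> S" by blast
    then show ?thesis using h(1) S(1) by (simp add: bij_betw_def)
  qed
  then have \<sigma>: "\<sigma> \<in> transitive_rotations n" using p by (auto simp: transitive_rotations_def)
  have "half_edge_iso h M (labelled_map n \<sigma>)"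
    using h \<sigma>h bij_betwE[OF h(1)] by (simp add: half_edge_iso_def)
  then have "rooted_map_iso M (labelled_map n \<sigma>)"
    using nonempty_rooted_map_axioms nonempty_rooted_mapI[OF assms(1) labelled_map_in_rooted_maps[OF assms(1) \<sigma>]]
      rooted_map_iso_iff_half_edge_iso by blast
  with \<sigma> show ?thesis by blast
qed

text \<open>The centraliser of the pairing within the stabiliser of the root half-edge: exactly the
  freedom left in labelling a rooted map.\<close>

definition relabellings :: "nat \<Rightarrow> (nat \<Rightarrow> nat) set" where
  "relabellings n = {\<pi>. \<pi> permutes {..<2 * n} \<and> \<pi> 0 = 0 \<and> (\<forall>i<2 * n. \<pi> (edge_flip i) = edge_flip (\<pi> i))}"

lemma card_relabellings_pos: "card (relabellings n) > 0"
proof -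
  have "id \<in> relabellings n" by (simp add: relabellings_def)
  moreover have "finite (relabellings n)"
    by (rule finite_subset[OF _ finite_permutations[of "{..<2 * n}"]]) (auto simp: relabellings_def)
  ultimately show ?thesis by (auto simp: card_gt_0_iff)
qed

text \<open>Root and pairing are the same in all labelled maps, so an isomorphism must preserve
  both, and what remains is conjugacy of the rotations.\<close>

lemma labelled_map_iso_iff:
  assumes "n > 0" and \<sigma>: "\<sigma> \<in> transitive_rotations n" and \<tau>: "\<tau> \<in> transitive_rotations n"
  shows "rooted_map_iso (labelled_map n \<sigma>) (labelled_map n \<tau>) \<longleftrightarrow>
    (\<exists>\<pi> \<in> relabellings n. \<tau> = map_permutation {..<2 * n} \<pi> \<sigma>)"
proof -
  let ?U = "{..<2 * n}"
  have p: "\<sigma> permutes ?U" "\<tau> permutes ?U" using \<sigma> \<tau> by (auto dest: transitive_rotationsD)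
  have "rooted_map_iso (labelled_map n \<sigma>) (labelled_map n \<tau>) \<longleftrightarrow>
      (\<exists>h. half_edge_iso h (labelled_map n \<sigma>) (labelled_map n \<tau>))"
    using nonempty_rooted_mapI[OF assms(1) labelled_map_in_rooted_maps[OF assms(1)]] \<sigma> \<tau>
    by (intro rooted_map_iso_iff_half_edge_iso) auto
  also have "\<dots> \<longleftrightarrow> (\<exists>h. bij_betw h ?U ?U \<and> (\<forall>i<2 * n. h (edge_flip i) = edge_flip (h i) \<and> h (\<sigma> i) = \<tau> (h i)) \<and> h 0 = 0)"
    using bij_betwE[of _ ?U ?U] by (intro ex_cong1) (auto simp: half_edge_iso_def)
  also have "\<dots> \<longleftrightarrow> (\<exists>\<pi> \<in> relabellings n. \<tau> = map_permutation ?U \<pi> \<sigma>)"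
  proof
    assume "\<exists>h. bij_betw h ?U ?U \<and> (\<forall>i<2 * n. h (edge_flip i) = edge_flip (h i) \<and> h (\<sigma> i) = \<tau> (h i)) \<and> h 0 = 0"
    then obtain h where h: "bij_betw h ?U ?U" "\<And>i. i < 2 * n \<Longrightarrow> h (edge_flip i) = edge_flip (h i)"
      "\<And>i. i < 2 * n \<Longrightarrow> h (\<sigma> i) = \<tau> (h i)" "h 0 = 0" by blast
    \<comment> \<open>The isomorphism h is unconstrained outside the labels; resetting it to the
      identity there makes it a permutation.\<close>
    define \<pi> where "\<pi> = restrict_id h ?U"
    have \<pi>: "\<pi> permutes ?U" unfolding \<pi>_def using h(1) by (rule permutes_restrict_id)
    have eq: "\<pi> i = h i" if "i < 2 * n" for i using that by (simp add: \<pi>_def)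
    have "\<pi> \<in> relabellings n" using \<pi> h assms(1) by (simp add: relabellings_def eq)
    moreover have "\<tau> = map_permutation ?U \<pi> \<sigma>"
    proof
      fix j
      have mp: "map_permutation ?U \<pi> \<sigma> permutes ?U"
        using permutes_imp_bij[OF \<pi>] p(1) by (rule map_permutation_permutes)
      show "\<tau> j = map_permutation ?U \<pi> \<sigma> j"
      proof (cases "j \<in> ?U")
        case True
        then obtain i where i: "i < 2 * n" "j = \<pi> i" using permutes_image[OF \<pi>] by blast
        then have "map_permutation ?U \<pi> \<sigma> j = \<pi> (\<sigma> i)"
          using permutes_inj_on[OF \<pi>] by (simp add: map_permutation_apply)
        also have "\<dots> = \<tau> j" using i p permutes_in_image[OF p(1), of i] by (simp add: eq h)
        finally show ?thesis ..
      next
        case False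
        then show ?thesis using p(2) mp by (metis permutes_not_in)
      qed
    qed
    ultimately show "\<exists>\<pi> \<in> relabellings n. \<tau> = map_permutation ?U \<pi> \<sigma>" by blast
  next
    assume "\<exists>\<pi> \<in> relabellings n. \<tau> = map_permutation ?U \<pi> \<sigma>"
    then obtain \<pi> where \<pi>: "\<pi> \<in> relabellings n" "\<tau> = map_permutation ?U \<pi> \<sigma>" ..
    then have "\<pi> permutes ?U" by (simp add: relabellings_def)
    then have "bij_betw \<pi> ?U ?U" "inj_on \<pi> ?U" by (auto intro: permutes_imp_bij permutes_inj_on)
    then show "\<exists>h. bij_betw h ?U ?U \<and> (\<forall>i<2 * n. h (edge_flip i) = edge_flip (h i) \<and> h (\<sigma> i) = \<tau> (h i)) \<and> h 0 = 0"
      using \<pi> by (intro exI[of _ \<pi>]) (auto simp: relabellings_def map_permutation_apply)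
  qed
  finally show ?thesis .
qed

text \<open>Invariant sets of the conjugate pull back along \<pi> to invariant sets of \<sigma>.
  Hence conjugation acts on the transitive rotations.\<close>

lemma map_permutation_relabelling:
  assumes \<pi>: "\<pi> \<in> relabellings n" and \<sigma>: "\<sigma> \<in> transitive_rotations n"
  shows "map_permutation {..<2 * n} \<pi> \<sigma> \<in> transitive_rotations n"
proof -
  let ?U = "{..<2 * n}" and ?\<tau> = "map_permutation {..<2 * n} \<pi> \<sigma>"
  have perm: "\<pi> permutes ?U" using \<pi> by (simp add: relabellings_def)
  have p: "\<sigma> permutes ?U" using \<sigma> by (rule transitive_rotationsD)
  have \<tau>: "?\<tau> (\<pi> i) = \<pi> (\<sigma> i)" if "i < 2 * n" for i
    using permutes_inj_on[OF perm] that by (simp add: map_permutation_apply)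
  have "S = ?U" if S: "S \<subseteq> ?U" "0 \<in> S" "?\<tau> ` S \<subseteq> S" "edge_flip ` S \<subseteq> S" for S
  proof -
    let ?S = "{i \<in> ?U. \<pi> i \<in> S}"
    have "\<sigma> ` ?S \<subseteq> ?S"
    proof (rule image_subsetI)
      fix i assume i: "i \<in> ?S"
      then have "\<pi> (\<sigma> i) \<in> S" using S(3) \<tau>[of i] by (auto simp flip: \<tau>)
      then show "\<sigma> i \<in> ?S" using i permutes_in_image[OF p, of i] by simp
    qed
    moreover have "edge_flip ` ?S \<subseteq> ?S" using S(4) \<pi> by (auto simp: relabellings_def)
    moreover have "0 \<in> ?S" using \<pi> S by (auto simp: relabellings_def)
    moreover have "?S \<subseteq> ?U" by blast
    ultimately have "?S = ?U" by (intro transitive_rotationsD(2)[OF \<sigma>])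
    then have "\<pi> ` ?U \<subseteq> S" by blast
    then show ?thesis using S(1) permutes_image[OF perm] by simp
  qed
  then show ?thesis
    using map_permutation_permutes[OF permutes_imp_bij[OF perm] p] by (auto simp: transitive_rotations_def)
qed

text \<open>A rooted map has no automorphism: the set of half-edges on which two relabellings agree
  contains the root and is invariant.\<close>
lemma inj_on_map_permutation_relabellings:
  assumes "n > 0" and \<sigma>: "\<sigma> \<in> transitive_rotations n"
  shows "inj_on (\<lambda>\<pi>. map_permutation {..<2 * n} \<pi> \<sigma>) (relabellings n)"
proof (rule inj_onI)
  let ?U = "{..<2 * n}"
  fix \<pi> \<rho> assume \<pi>: "\<pi> \<in> relabellings n" and \<rho>: "\<rho> \<in> relabellings n"
    and eq: "map_permutation ?U \<pi> \<sigma> = map_permutation ?U \<rho> \<sigma>"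
  have p: "\<sigma> permutes ?U" using \<sigma> by (rule transitive_rotationsD)
  have perm: "\<pi> permutes ?U" "\<rho> permutes ?U" using \<pi> \<rho> by (auto simp: relabellings_def)
  let ?S = "{i \<in> ?U. \<pi> i = \<rho> i}"
  have "\<sigma> i \<in> ?S" if i: "i \<in> ?S" for i
  proof -
    have "i \<in> ?U" using i by simp
    then have "map_permutation ?U \<pi> \<sigma> (\<pi> i) = \<pi> (\<sigma> i)" "map_permutation ?U \<rho> \<sigma> (\<rho> i) = \<rho> (\<sigma> i)"
      using perm by (simp_all only: map_permutation_apply permutes_inj_on)
    then have "\<pi> (\<sigma> i) = \<rho> (\<sigma> i)" using eq i by simp
    then show ?thesis using i permutes_in_image[OF p, of i] by simp
  qed
  then have "\<sigma> ` ?S \<subseteq> ?S" by blast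
  moreover have "edge_flip ` ?S \<subseteq> ?S" using \<pi> \<rho> by (auto simp: relabellings_def)
  moreover have "0 \<in> ?S" using \<pi> \<rho> assms(1) by (auto simp: relabellings_def)
  moreover have "?S \<subseteq> ?U" by blast
  ultimately have S: "?S = ?U" by (intro transitive_rotationsD(2)[OF \<sigma>])
  show "\<pi> = \<rho>"
  proof
    fix i
    show "\<pi> i = \<rho> i"
    proof (cases "i \<in> ?U")
      case True
      then have "i \<in> ?S" by (simp only: S)
      then show ?thesis by simp
    next
      case False
      then show ?thesis by (simp add: permutes_not_in[OF perm(1)] permutes_not_in[OF perm(2)])
    qed
  qed
qed

section \<open>Isomorphism classes and their number of labellings\<close>

definition labelled_class :: "nat \<Rightarrow> (nat \<Rightarrow> nat) \<Rightarrow> (nat, nat) rooted_map set" where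
  "labelled_class n \<sigma> = {M \<in> rooted_maps n. rooted_map_iso (labelled_map n \<sigma>) M}"

lemma equiv_rooted_map_iso:
  assumes "n > 0"
  shows "equiv (rooted_maps n) {(M, N). M \<in> rooted_maps n \<and> N \<in> rooted_maps n \<and> rooted_map_iso M N}"
proof -
  have iff: "rooted_map_iso M N \<longleftrightarrow> (\<exists>h. half_edge_iso h M N)" if "M \<in> rooted_maps n" "N \<in> rooted_maps n" for M N
    using that assms by (intro rooted_map_iso_iff_half_edge_iso nonempty_rooted_mapI)
  show ?thesis
  proof (rule equivI)
    show "refl_on (rooted_maps n) {(M, N). M \<in> rooted_maps n \<and> N \<in> rooted_maps n \<and> rooted_map_iso M N}"
      using nonempty_rooted_map.half_edge_iso_id nonempty_rooted_mapI[OF assms]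
      by (auto simp: refl_on_def iff)
    show "sym {(M, N). M \<in> rooted_maps n \<and> N \<in> rooted_maps n \<and> rooted_map_iso M N}"
      using nonempty_rooted_map.half_edge_iso_inv nonempty_rooted_mapI[OF assms]
      by (fastforce simp: sym_def iff)
    show "trans {(M, N). M \<in> rooted_maps n \<and> N \<in> rooted_maps n \<and> rooted_map_iso M N}"
      using half_edge_iso_trans by (fastforce simp: trans_def iff)
  qed auto
qed

lemma labelled_class_eq_iff:
  assumes "n > 0" and \<sigma>: "\<sigma> \<in> transitive_rotations n" and \<tau>: "\<tau> \<in> transitive_rotations n"
  shows "labelled_class n \<sigma> = labelled_class n \<tau> \<longleftrightarrow> rooted_map_iso (labelled_map n \<sigma>) (labelled_map n \<tau>)"
proof -
  let ?R = "{(M, N). M \<in> rooted_maps n \<and> N \<in> rooted_maps n \<and> rooted_map_iso M N}"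
  have in_maps: "labelled_map n \<sigma> \<in> rooted_maps n" "labelled_map n \<tau> \<in> rooted_maps n"
    using assms by (auto intro: labelled_map_in_rooted_maps)
  then have "labelled_class n \<sigma> = ?R `` {labelled_map n \<sigma>}" "labelled_class n \<tau> = ?R `` {labelled_map n \<tau>}"
    by (auto simp: labelled_class_def)
  then show ?thesis
    using eq_equiv_class_iff[OF equiv_rooted_map_iso[OF assms(1)] in_maps] in_maps by simp
qed

lemma rooted_map_classes_eq:
  assumes "n > 0"
  shows "rooted_map_classes n = labelled_class n ` transitive_rotations n"
proof -
  let ?R = "{(M, N). M \<in> rooted_maps n \<and> N \<in> rooted_maps n \<and> rooted_map_iso M N}"
  have cls: "labelled_class n \<sigma> = ?R `` {labelled_map n \<sigma>}" if "\<sigma> \<in> transitive_rotations n" for \<sigma>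
    using labelled_map_in_rooted_maps[OF assms that] by (simp add: labelled_class_def Image_def)
  show ?thesis
  proof (intro equalityI subsetI)
    fix C assume "C \<in> rooted_map_classes n"
    then obtain M where M: "M \<in> rooted_maps n" "C = ?R `` {M}"
      by (auto simp: rooted_map_classes_def elim: quotientE)
    obtain \<sigma> where \<sigma>: "\<sigma> \<in> transitive_rotations n" "rooted_map_iso M (labelled_map n \<sigma>)"
      using ex_labelled_map[OF assms M(1)] by blast
    have "C = ?R `` {labelled_map n \<sigma>}"
      unfolding M(2) using M(1) \<sigma> labelled_map_in_rooted_maps[OF assms \<sigma>(1)]
      by (intro equiv_class_eq[OF equiv_rooted_map_iso[OF assms]]) simp
    then show "C \<in> labelled_class n ` transitive_rotations n" using cls \<sigma>(1) by auto
  next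
    fix C assume "C \<in> labelled_class n ` transitive_rotations n"
    then obtain \<sigma> where \<sigma>: "\<sigma> \<in> transitive_rotations n" "C = ?R `` {labelled_map n \<sigma>}"
      using cls by blast
    show "C \<in> rooted_map_classes n"
      unfolding rooted_map_classes_def \<sigma>(2) using labelled_map_in_rooted_maps[OF assms \<sigma>(1)]
      by (rule quotientI)
  qed
qed

text \<open>An isomorphism carries the cycle of \<sigma> through 0 injectively onto the root cycle
  of any member, so the degree is constant on the class and \<open>the_elem\<close> is well
  defined.\<close>

lemma class_root_degree_labelled_class:
  assumes "n > 0" and \<sigma>: "\<sigma> \<in> transitive_rotations n"
  shows "class_root_degree (labelled_class n \<sigma>) = card (orbit \<sigma> 0)"
proof -
  let ?M = "labelled_map n \<sigma>"
  have M: "?M \<in> rooted_maps n" using assms by (rule labelled_map_in_rooted_maps)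
  interpret M: nonempty_rooted_map ?M using assms(1) M by (rule nonempty_rooted_mapI)
  have "root_degree N = card (orbit \<sigma> 0)" if N: "N \<in> labelled_class n \<sigma>" for N
  proof -
    interpret N: nonempty_rooted_map N
      using nonempty_rooted_mapI[OF assms(1)] N by (auto simp: labelled_class_def)
    obtain h where h: "half_edge_iso h ?M N"
      using N rooted_map_iso_iff_half_edge_iso[OF M.nonempty_rooted_map_axioms N.nonempty_rooted_map_axioms]
      by (auto simp: labelled_class_def)
    have z: "0 \<in> arcs M.G" using M.root_arc_in_arcs by simp
    then have "orbit (rot N) (root_arc N) = h ` orbit \<sigma> 0"
      using M.half_edge_iso_orbit[OF h z] h by (simp add: half_edge_iso_def)
    moreover have "inj_on h (orbit \<sigma> 0)"
      using h M.orbit_rot[OF z] by (auto simp: half_edge_iso_def bij_betw_def elim!: inj_on_subset)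
    ultimately show ?thesis by (simp add: N.root_degree_eq card_image)
  qed
  moreover have "?M \<in> labelled_class n \<sigma>"
    using M equiv_class_self[OF equiv_rooted_map_iso[OF assms(1)] M] by (simp add: labelled_class_def)
  ultimately have "root_degree ` labelled_class n \<sigma> = {card (orbit \<sigma> 0)}" by auto
  then show ?thesis by (simp add: class_root_degree_def)
qed

text \<open>The fibre is the orbit of \<sigma> under conjugation by relabellings, and the absence of
  automorphisms makes the orbit map injective.\<close>

lemma card_labelled_class_fibre:
  assumes "n > 0" and \<sigma>: "\<sigma> \<in> transitive_rotations n"
  shows "card {\<tau> \<in> transitive_rotations n. labelled_class n \<tau> = labelled_class n \<sigma>} = card (relabellings n)"
proof -
  have "{\<tau> \<in> transitive_rotations n. labelled_class n \<tau> = labelled_class n \<sigma>}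
      = {\<tau> \<in> transitive_rotations n. labelled_class n \<sigma> = labelled_class n \<tau>}" by auto
  also have "\<dots> = (\<lambda>\<pi>. map_permutation {..<2 * n} \<pi> \<sigma>) ` relabellings n"
    using labelled_class_eq_iff[OF assms] labelled_map_iso_iff[OF assms] map_permutation_relabelling[OF _ \<sigma>]
    by blast
  finally show ?thesis using inj_on_map_permutation_relabellings[OF assms] by (simp add: card_image)
qed

text \<open>The arbitrary predicate lets one count serve both the favourable classes and, with the
  constant \<open>True\<close>, all classes.\<close>

lemma card_rooted_map_classes_root_degree:
  assumes "n > 0"
  shows "card {\<sigma> \<in> transitive_rotations n. P (card (orbit \<sigma> 0))}
    = card {C \<in> rooted_map_classes n. P (class_root_degree C)} * card (relabellings n)"
proof -
  let ?C = "{C \<in> rooted_map_classes n. P (class_root_degree C)}"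
  let ?F = "\<lambda>C. {\<sigma> \<in> transitive_rotations n. labelled_class n \<sigma> = C}"
  have "finite ?C" using finite_transitive_rotations by (simp add: rooted_map_classes_eq[OF assms])
  have "{\<sigma> \<in> transitive_rotations n. P (card (orbit \<sigma> 0))} = (\<Union>C\<in>?C. ?F C)"
    by (auto simp: rooted_map_classes_eq[OF assms] class_root_degree_labelled_class[OF assms])
      (metis class_root_degree_labelled_class[OF assms])
  also have "card \<dots> = (\<Sum>C\<in>?C. card (?F C))"
    using \<open>finite ?C\<close> finite_transitive_rotations by (intro card_UN_disjoint) auto
  also have "\<dots> = (\<Sum>C\<in>?C. card (relabellings n))"
    using card_labelled_class_fibre[OF assms] by (intro sum.cong) (auto simp: rooted_map_classes_eq[OF assms])
  finally show ?thesis by simp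
qed

section \<open>Convergence of the root degree\<close>

lemma cdf_uniform_0_2: "cdf (uniform_measure lborel {0..2}) x = (if x < 0 then 0 else min (x / 2) 1)"
proof -
  have "cdf (uniform_measure lborel {0..2}) x = measure lborel ({0..2} \<inter> {..x}) / measure lborel {0..2::real}"
    unfolding cdf_def by (rule measure_uniform_measure) auto
  also have "{0..2} \<inter> {..x} = {0..min 2 x}" by auto
  also have "measure lborel {0..min 2 x} / measure lborel {0..2::real} = (if x < 0 then 0 else min (x / 2) 1)"
    by (simp add: min_def)
  finally show ?thesis .
qed

definition rotations_root_degree_le :: "nat \<Rightarrow> real \<Rightarrow> (nat \<Rightarrow> nat) set" where
  "rotations_root_degree_le n x = {\<sigma>. \<sigma> permutes {..<2 * n} \<and> real (card (orbit \<sigma> 0)) / real n \<le> x}"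

lemma card_rotations_root_degree_le:
  assumes "n > 0"
  shows "real (card (rotations_root_degree_le n x)) / fact (2 * n)
    = (if x < 0 then 0 else min (real_of_int \<lfloor>x * real n\<rfloor> / real (2 * n)) 1)"
proof (cases "x < 0")
  case True
  then have "rotations_root_degree_le n x = {}"
    using assms by (auto simp: rotations_root_degree_le_def not_le intro: less_le_trans)
  then show ?thesis using True by simp
next
  case False
  \<comment> \<open>A natural number d satisfies d / n \<le> x exactly when d is at most the floor
    of x n, which turns the event into a bound on an integer cycle length.\<close>
  define t where "t = nat \<lfloor>x * real n\<rfloor>"
  have "real d / real n \<le> x \<longleftrightarrow> d \<le> t" for d
    using False assms by (simp add: t_def field_simps le_nat_iff le_floor_iff)
  then have "card (rotations_root_degree_le n x) = min t (2 * n) * fact (2 * n - 1)"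
    using card_permutes_orbit_le[of "{..<2 * n}" 0 t] assms by (simp add: rotations_root_degree_le_def)
  moreover have "fact (2 * n) = real (2 * n) * fact (2 * n - 1)"
    using assms by (intro fact_reduce) simp
  ultimately have "real (card (rotations_root_degree_le n x)) / fact (2 * n) = real (min t (2 * n)) / real (2 * n)"
    using assms by simp
  also have "\<dots> = min (real t / real (2 * n)) 1" using assms by (simp add: min_def field_simps)
  finally show ?thesis using False by (simp add: t_def)
qed

lemma tendsto_card_rotations_root_degree_le:
  "(\<lambda>n. real (card (rotations_root_degree_le n x)) / fact (2 * n)) \<longlonglongrightarrow> cdf (uniform_measure lborel {0..2}) x"
proof (cases "x < 0")
  case True
  have "eventually (\<lambda>n. real (card (rotations_root_degree_le n x)) / fact (2 * n) = 0) sequentially"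
    using eventually_gt_at_top[of 0] by eventually_elim (use True in \<open>simp add: card_rotations_root_degree_le\<close>)
  then show ?thesis using True by (simp add: cdf_uniform_0_2 tendsto_eventually)
next
  case False
  have "(\<lambda>n. real_of_int \<lfloor>x * real n\<rfloor> / real (2 * n)) \<longlonglongrightarrow> x / 2"
  proof (rule tendsto_sandwich)
    show "eventually (\<lambda>n. (x * real n - 1) / real (2 * n) \<le> real_of_int \<lfloor>x * real n\<rfloor> / real (2 * n)) sequentially"
      by (intro always_eventually allI divide_right_mono) linarith+
    show "eventually (\<lambda>n. real_of_int \<lfloor>x * real n\<rfloor> / real (2 * n) \<le> x * real n / real (2 * n)) sequentially"
      by (intro always_eventually allI divide_right_mono) linarith+
    show "(\<lambda>n. (x * real n - 1) / real (2 * n)) \<longlonglongrightarrow> x / 2" by real_asymp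
    show "(\<lambda>n. x * real n / real (2 * n)) \<longlonglongrightarrow> x / 2" by real_asymp
  qed
  then have "(\<lambda>n. min (real_of_int \<lfloor>x * real n\<rfloor> / real (2 * n)) 1) \<longlonglongrightarrow> min (x / 2) 1"
    by (intro tendsto_min tendsto_const)
  moreover have "eventually (\<lambda>n. min (real_of_int \<lfloor>x * real n\<rfloor> / real (2 * n)) 1
      = real (card (rotations_root_degree_le n x)) / fact (2 * n)) sequentially"
    using eventually_gt_at_top[of 0] by eventually_elim (use False in \<open>simp add: card_rotations_root_degree_le\<close>)
  ultimately show ?thesis using False by (simp add: cdf_uniform_0_2 Lim_transform_eventually)
qed

lemma tendsto_card_transitive_rotations:
  "(\<lambda>n. real (card (transitive_rotations n)) / fact (2 * n)) \<longlonglongrightarrow> 1"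
  and tendsto_card_transitive_rotations_root_degree_le:
  "(\<lambda>n. real (card (transitive_rotations n \<inter> rotations_root_degree_le n x)) / fact (2 * n))
     \<longlonglongrightarrow> cdf (uniform_measure lborel {0..2}) x"
proof -
  let ?T = transitive_rotations and ?A = "\<lambda>n. {\<sigma>. \<sigma> permutes {..<2 * n}}"
  let ?Q = "\<lambda>n. rotations_root_degree_le n x"
  have finA: "finite (?A n)" and T: "?T n \<subseteq> ?A n" and Q: "?Q n \<subseteq> ?A n" for n :: nat
    by (auto simp: finite_permutations transitive_rotations_def rotations_root_degree_le_def)
  have cardA: "real (card (?A n)) = fact (2 * n)" for n by (simp add: card_permutations)
  \<comment> \<open>The proportion of non-transitive rotations is the single error term: it bounds
    both the deficit of the total count and the loss in the event.\<close>
  define b where "b n = real (card (?A n - ?T n)) / fact (2 * n)" for n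
  have b: "b \<longlonglongrightarrow> 0"
  proof (rule tendsto_sandwich[of "\<lambda>_. 0" b _ "\<lambda>n. 4 / real n"])
    show "eventually (\<lambda>n. b n \<le> 4 / real n) sequentially"
      using eventually_ge_at_top[of 2]
      by eventually_elim (use card_not_transitive_le in \<open>simp add: b_def divide_le_eq\<close>)
    show "(\<lambda>n. 4 / real n) \<longlonglongrightarrow> 0" by real_asymp
    show "eventually (\<lambda>n. 0 \<le> b n) sequentially" by (simp add: b_def)
  qed simp
  have eq: "card (?T n) + card (?A n - ?T n) = card (?A n)" for n
    using finA T card_Un_disjoint[of "?T n" "?A n - ?T n"] by (simp add: finite_subset[OF T] Un_absorb1)
  have "real (card (?T n)) + real (card (?A n - ?T n)) = fact (2 * n)" for n
    using arg_cong[OF eq, of real n] by (simp only: of_nat_add cardA)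
  then have "real (card (?T n)) / fact (2 * n) = 1 - b n" for n
    by (simp add: b_def eq_divide_eq diff_divide_distrib eq_diff_eq flip: add_divide_distrib)
  then show "(\<lambda>n. real (card (?T n)) / fact (2 * n)) \<longlonglongrightarrow> 1"
    using tendsto_diff[OF tendsto_const[of 1] b] by simp
  have "card (?Q n) \<le> card (?T n \<inter> ?Q n) + card (?A n - ?T n)" for n
  proof -
    have "card (?Q n) \<le> card ((?T n \<inter> ?Q n) \<union> (?A n - ?T n))"
      using T[of n] Q[of n] by (intro card_mono finite_subset[OF _ finA[of n]]) blast+
    also have "\<dots> \<le> card (?T n \<inter> ?Q n) + card (?A n - ?T n)" by (rule card_Un_le)
    finally show ?thesis .
  qed
  then have "real (card (?Q n)) \<le> real (card (?T n \<inter> ?Q n)) + real (card (?A n - ?T n))" for n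
    by (metis of_nat_add of_nat_mono)
  then have lower: "real (card (?Q n)) / fact (2 * n) - b n \<le> real (card (?T n \<inter> ?Q n)) / fact (2 * n)" for n
    by (simp add: b_def diff_le_eq divide_right_mono flip: add_divide_distrib)
  have "card (?T n \<inter> ?Q n) \<le> card (?Q n)" for n
    using Q[of n] by (intro card_mono finite_subset[OF _ finA[of n]]) blast+
  then have upper: "real (card (?T n \<inter> ?Q n)) / fact (2 * n) \<le> real (card (?Q n)) / fact (2 * n)" for n
    by (simp add: divide_right_mono)
  show "(\<lambda>n. real (card (?T n \<inter> ?Q n)) / fact (2 * n)) \<longlonglongrightarrow> cdf (uniform_measure lborel {0..2}) x"
  proof (rule tendsto_sandwich)
    show "(\<lambda>n. real (card (?Q n)) / fact (2 * n) - b n) \<longlonglongrightarrow> cdf (uniform_measure lborel {0..2}) x"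
      using tendsto_diff[OF tendsto_card_rotations_root_degree_le b] by simp
    show "(\<lambda>n. real (card (?Q n)) / fact (2 * n)) \<longlonglongrightarrow> cdf (uniform_measure lborel {0..2}) x"
      by (rule tendsto_card_rotations_root_degree_le)
  qed (use lower upper in auto)
qed

text \<open>Numerator and denominator both carry the factor \<open>card (relabellings n)\<close>,
  which is positive and cancels; a nonempty set of rotations gives \<open>pmf_of_set\<close> its
  intended meaning.\<close>

lemma prob_root_degree_le:
  assumes "n > 0" "transitive_rotations n \<noteq> {}"
  shows "measure_pmf.prob (random_rooted_map n) {C. real (class_root_degree C) / real n \<le> x}
    = real (card (transitive_rotations n \<inter> rotations_root_degree_le n x)) / real (card (transitive_rotations n))"
proof -
  let ?P = "\<lambda>d. real d / real n \<le> x"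
  have fin: "finite (rooted_map_classes n)" and ne: "rooted_map_classes n \<noteq> {}"
    using finite_transitive_rotations assms by (simp_all add: rooted_map_classes_eq[OF assms(1)])
  have "transitive_rotations n \<inter> rotations_root_degree_le n x
      = {\<sigma> \<in> transitive_rotations n. ?P (card (orbit \<sigma> 0))}"
    by (auto simp: transitive_rotations_def rotations_root_degree_le_def)
  then have "card (transitive_rotations n \<inter> rotations_root_degree_le n x)
      = card {C \<in> rooted_map_classes n. ?P (class_root_degree C)} * card (relabellings n)"
    using card_rooted_map_classes_root_degree[OF assms(1), of ?P] by simp
  moreover have "card (transitive_rotations n) = card (rooted_map_classes n) * card (relabellings n)"
    using card_rooted_map_classes_root_degree[OF assms(1), of "\<lambda>_. True"] by simp
  moreover have "rooted_map_classes n \<inter> {C. ?P (class_root_degree C)}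
      = {C \<in> rooted_map_classes n. ?P (class_root_degree C)}" by auto
  ultimately show ?thesis
    using card_relabellings_pos[of n] measure_pmf_of_set[OF ne fin, of "{C. ?P (class_root_degree C)}"]
    by (simp add: random_rooted_map_def)
qed

theorem theorem7:
  shows "weak_conv_m
    (\<lambda>n. distr (measure_pmf (random_rooted_map n)) borel
            (\<lambda>C. real (class_root_degree C) / real n))
    (uniform_measure lborel {0..2})"
proof -
  let ?T = transitive_rotations
  let ?D = "\<lambda>n. distr (measure_pmf (random_rooted_map n)) borel (\<lambda>C. real (class_root_degree C) / real n)"
  \<comment> \<open>The limit distribution function is continuous, so convergence is shown at every
    x rather than only at continuity points.\<close>
  have "(\<lambda>n. cdf (?D n) x) \<longlonglongrightarrow> cdf (uniform_measure lborel {0..2}) x" for x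
  proof -
    have cdf: "cdf (?D n) x = measure_pmf.prob (random_rooted_map n) {C. real (class_root_degree C) / real n \<le> x}" for n
      by (simp add: cdf_def measure_distr vimage_def)
    \<comment> \<open>A proportion tending to 1 is eventually positive, so transitive rotations
      exist for large n and the quotient is legitimate. The degenerate index n = 0, where division
      yields 0 by convention, is discarded in the same way.\<close>
    have "eventually (\<lambda>n. real (card (?T n)) / fact (2 * n) > 0) sequentially"
      using order_tendstoD(1)[OF tendsto_card_transitive_rotations, of 0] by simp
    then have ev: "eventually (\<lambda>n. real (card (?T n \<inter> rotations_root_degree_le n x)) / fact (2 * n)
        / (real (card (?T n)) / fact (2 * n)) = cdf (?D n) x) sequentially"
      using eventually_gt_at_top[of 0]
    proof eventually_elim
      case (elim n)
      then have "?T n \<noteq> {}" by auto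
      with elim show ?case by (simp add: cdf prob_root_degree_le)
    qed
    show ?thesis
      using Lim_transform_eventually[OF tendsto_divide[OF tendsto_card_transitive_rotations_root_degree_le
          tendsto_card_transitive_rotations] ev] by simp
  qed
  then show ?thesis by (simp add: weak_conv_m_def weak_conv_def)
qed

end
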